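(* Let $D\in\{0,1\}^{m\times n}$ be a binary data matrix, let $X\in\{0,1\}^{n\times r}$ and $Y\in\{0,1\}^{m\times r}$ be binary matrices, and let $\mu=1+\log(n)$. Let $f^D_{\mathsf{CT}}(X,Y,D)$ be the code-table description size of the data, defined in the context. Then $$f^D_{\mathsf{CT}}(X,Y,D)\le \mu\,\|D-YX^T\|^2-\sum_{s=1}^r\left(|Y_{\cdot s}|+1\right)\log\left(\frac{|Y_{\cdot s}|+1}{|Y|+r}\right)+|Y|.$$
   Context: Here $m,n,r\ge 1$ are integers, $\log$ is the natural logarithm, $\|\cdot\|$ is the Frobenius norm and $|\cdot|$ is the entry-wise $1$-norm (the sum of absolute values of all entries of a matrix or vector). $Z_{\cdot s}$ denotes the $s$-th column of a matrix $Z$. The product $YX^T$ is taken over the reals (ordinary matrix product). The function $\theta$ acts entry-wise, with $\theta(x)=1$ if $x\ge 0.5$ and $\theta(x)=0$ otherwise, so $\theta(YX^T)$ is the Boolean matrix product. The noise matrix is $N=D-\theta(YX^T)\in\{-1,0,1\}^{m\times n}$. Set $$p_s=\frac{|Y_{\cdot s}|}{|Y|+|N|}\ (1\le s\le r),\qquad p_{r+i}=\frac{|N_{\cdot i}|}{|Y|+|N|}\ (1\le i\le n).$$ The description size of the data is $$f^D_{\mathsf{CT}}(X,Y,D)=-\sum_{s=1}^r|Y_{\cdot s}|\cdot\log(p_s)-\sum_{i=1}^n|N_{\cdot i}|\cdot\log(p_{r+i}),$$ with the convention that a term whose prefactor $|Y_{\cdot s}|$ or $|N_{\cdot i}|$ is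 $0$ contributes $0$. *)

theory Defs
  imports "HOL-Analysis.Analysis"
begin

definition binary_matrix :: "real ^ 'b ^ 'a \<Rightarrow> bool" where
  "binary_matrix A \<longleftrightarrow> (\<forall>i j. A $ i $ j \<in> {0, 1})"

text \<open>The Frobenius norm needs no definition: \<open>norm\<close> on \<open>real ^ 'b ^ 'a\<close> is the Euclidean norm of
  the vector of Euclidean norms of the rows.  The entry-wise 1-norm is defined separately for
  vectors and for matrices.\<close>

definition vec_norm1 :: "real ^ 'a \<Rightarrow> real" where
  "vec_norm1 v = (\<Sum>i\<in>UNIV. \<bar>v $ i\<bar>)"

definition mat_norm1 :: "real ^ 'b ^ 'a \<Rightarrow> real" where
  "mat_norm1 A = (\<Sum>i\<in>UNIV. \<Sum>j\<in>UNIV. \<bar>A $ i $ j\<bar>)"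

definition theta :: "real \<Rightarrow> real" where
  "theta x = (if x \<ge> 1/2 then 1 else 0)"

definition theta_matrix :: "real ^ 'b ^ 'a \<Rightarrow> real ^ 'b ^ 'a" where
  "theta_matrix A = (\<chi> i j. theta (A $ i $ j))"

definition noise_matrix ::
  "real ^ 'r ^ 'n \<Rightarrow> real ^ 'r ^ 'm \<Rightarrow> real ^ 'n ^ 'm \<Rightarrow> real ^ 'n ^ 'm" where
  "noise_matrix X Y D = D - theta_matrix (Y ** transpose X)"

text \<open>The index set \<open>{1..r+n}\<close> of the code probabilities is rendered as the sum type \<open>'r + 'n\<close>:
  \<open>Inl s\<close> stands for the index \<open>s\<close> and \<open>Inr i\<close> for the index \<open>r + i\<close>.\<close>

definition code_prob ::
  "real ^ 'r ^ 'n \<Rightarrow> real ^ 'r ^ 'm \<Rightarrow> real ^ 'n ^ 'm \<Rightarrow> 'r + 'n \<Rightarrow> real" where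
  "code_prob X Y D k =
    (case k of
       Inl s \<Rightarrow> vec_norm1 (column s Y)
     | Inr i \<Rightarrow> vec_norm1 (column i (noise_matrix X Y D)))
    / (mat_norm1 Y + mat_norm1 (noise_matrix X Y D))"

text \<open>The convention that terms with prefactor \<open>0\<close> vanish holds automatically, because \<open>ln\<close> is a
  total function and \<open>0 * ln p = 0\<close> whatever the value of \<open>p\<close>.\<close>

definition f_CT :: "real ^ 'r ^ 'n \<Rightarrow> real ^ 'r ^ 'm \<Rightarrow> real ^ 'n ^ 'm \<Rightarrow> real" where
  "f_CT X Y D =
    - (\<Sum>s\<in>UNIV. vec_norm1 (column s Y) * ln (code_prob X Y D (Inl s)))
    - (\<Sum>i\<in>UNIV. vec_norm1 (column i (noise_matrix X Y D)) * ln (code_prob X Y D (Inr i)))"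

end

(* By Gibbs' inequality the optimal code lengths - ln (p k) may be replaced by - ln (q k) for any
   subprobability q.  Take q to be a mixture: with weight |Y| / (|Y| + |N|) the smoothed frequencies
   (|Y_s| + 1) / (|Y| + r), and with weight |N| / (|Y| + |N|) the uniform distribution on the n noise
   symbols.  The mixture weights cost at most |Y| + |N| by ln x \<le> x - 1, raising the prefactor |Y_s|
   to |Y_s| + 1 only adds a nonnegative code length, the uniform part costs |N| log n, and |N| is at
   most the squared error because the entries of Y X^T are natural numbers. *)

theory Submission imports Defs
begin

(* T is a common total that may exceed the sum of w, so that the inequality can be added up over
   separate groups of symbols; a term with w s = 0 contributes nothing, also when T = 0. *)
lemma gibbs_inequality_scaled:
  fixes w q :: "'a \<Rightarrow> real"
  assumes w: "\<And>s. s \<in> S \<Longrightarrow> 0 \<le> w s" "\<And>s. s \<in> S \<Longrightarrow> w s \<le> T"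
    and T: "0 \<le> T"
    and q: "\<And>s. s \<in> S \<Longrightarrow> 0 \<le> q s" "\<And>s. s \<in> S \<Longrightarrow> 0 < w s \<Longrightarrow> 0 < q s"
  shows "- (\<Sum>s\<in>S. w s * ln (w s / T)) \<le> - (\<Sum>s\<in>S. w s * ln (q s)) + T * sum q S - sum w S"
proof -
  \<comment> \<open>Gibbs holds term by term: for \<open>w s > 0\<close> this is
    \<open>ln x \<le> x - 1\<close> at \<open>x = T * q s / w s\<close>, multiplied by
    \<open>w s\<close>.\<close>
  have "w s * ln (q s) - w s * ln (w s / T) \<le> T * q s - w s" if s: "s \<in> S" for s
  proof (cases "w s = 0")
    case True
    then show ?thesis using T q(1)[OF s] by simp
  next
    case False
    then have pos: "0 < w s" "0 < T" "0 < q s"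
      using w[OF s] q(2)[OF s] by linarith+
    then have "ln (q s) - ln (w s / T) = ln (T * q s / w s)"
      by (simp add: ln_div ln_mult)
    also have "\<dots> \<le> T * q s / w s - 1"
      using pos by (intro ln_le_minus_one) simp
    finally have "w s * (ln (q s) - ln (w s / T)) \<le> w s * (T * q s / w s - 1)"
      using pos by (intro mult_left_mono) auto
    then show ?thesis using pos by (simp add: right_diff_distrib)
  qed
  then have "(\<Sum>s\<in>S. w s * ln (q s) - w s * ln (w s / T)) \<le> (\<Sum>s\<in>S. T * q s - w s)"
    by (rule sum_mono)
  then show ?thesis
    by (simp add: sum_subtractf sum_distrib_left)
qed

text \<open>The case of a single symbol with \<open>q = 1\<close>. It prices the mixture weights:
  each group pays at most the total weight of the other group.\<close>

lemma minus_mult_ln_ratio_le: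
  fixes a T :: real
  assumes "0 \<le> a" "a \<le> T"
  shows "- (a * ln (a / T)) \<le> T - a"
  using gibbs_inequality_scaled[of "{()}" "\<lambda>_. a" T "\<lambda>_. 1"] assms by simp

text \<open>The analytic core, free of matrices: \<open>a\<close> stands for the column sums of
  \<open>Y\<close> and \<open>b\<close> for those of the noise matrix.\<close>

lemma two_group_code_length_le:
  fixes a :: "'r::finite \<Rightarrow> real" and b :: "'n::finite \<Rightarrow> real"
  assumes a: "\<And>s. 0 \<le> a s" and b: "\<And>i. 0 \<le> b i"
  defines "A \<equiv> sum a UNIV" and "B \<equiv> sum b UNIV"
  shows "- (\<Sum>s\<in>UNIV. a s * ln (a s / (A + B))) - (\<Sum>i\<in>UNIV. b i * ln (b i / (A + B)))
    \<le> (1 + ln (real CARD('n))) * B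
      - (\<Sum>s\<in>UNIV. (a s + 1) * ln ((a s + 1) / (A + real CARD('r)))) + A"
proof -
  define n where "n = real CARD('n)"
  define r where "r = real CARD('r)"
  define T where "T = A + B"
  define p where "p s = (a s + 1) / (A + r)" for s
  \<comment> \<open>\<open>qa\<close> and \<open>qb\<close> are the two parts of the mixture. For
    \<open>T = 0\<close> both vanish, since division by \<open>0\<close> yields
    \<open>0\<close>.\<close>
  define qa where "qa s = p s * (A / T)" for s
  define qb :: "'n \<Rightarrow> real" where "qb i = B / T / n" for i
  have n: "0 < n" and r: "1 \<le> r"
    by (simp_all add: n_def r_def Suc_leI)
  have A: "0 \<le> A" and B: "0 \<le> B"
    using a b by (auto simp: A_def B_def intro: sum_nonneg)
  have aA: "a s \<le> A" for s
    unfolding A_def by (rule member_le_sum) (use a in auto)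
  have bB: "b i \<le> B" for i
    unfolding B_def by (rule member_le_sum) (use b in auto)
  have Ar: "0 < A + r"
    using A r by linarith
  have p_pos: "0 < p s" for s
    using a[of s] Ar by (simp add: p_def)
  have p_le: "p s \<le> 1" for s
    using aA[of s] r Ar by (simp add: p_def)
  have "sum p UNIV = 1"
    using Ar by (simp add: p_def sum_divide_distrib[symmetric] sum.distrib A_def r_def)
  then have "sum qa UNIV = A / T"
    by (simp add: qa_def flip: sum_distrib_right sum_divide_distrib)
  \<comment> \<open>The mass of \<open>qa\<close> is chosen so that the correction
    \<open>T * sum qa UNIV - A\<close> in the Gibbs bound cancels. If \<open>T = 0\<close>,
    nonnegativity forces \<open>A = 0\<close>.\<close>
  then have qa_mass: "T * sum qa UNIV = A"
    using A B by (cases "T = 0") (auto simp: T_def)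
  have "sum qb UNIV = B / T"
    using n by (simp add: qb_def n_def)
  then have qb_mass: "T * sum qb UNIV = B"
    using A B by (cases "T = 0") (auto simp: T_def)

  have "- (\<Sum>s\<in>UNIV. a s * ln (a s / T)) \<le> - (\<Sum>s\<in>UNIV. a s * ln (qa s)) + T * sum qa UNIV - A"
    unfolding A_def
  proof (rule gibbs_inequality_scaled)
    fix s
    show "a s \<le> T" using aA[of s] B by (simp add: T_def)
    show "0 \<le> qa s" using p_pos[of s] A B by (simp add: qa_def T_def)
    assume "0 < a s"
    then show "0 < qa s" using p_pos[of s] aA[of s] B by (simp add: qa_def T_def)
  qed (use a A B in \<open>auto simp: T_def\<close>)
  also have "\<dots> = - (\<Sum>s\<in>UNIV. a s * ln (p s) + a s * ln (A / T))"
  proof -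
    \<comment> \<open>A nonzero \<open>a s\<close> forces \<open>A > 0\<close>, so that the
      logarithm of the product splits.\<close>
    have "a s * ln (qa s) = a s * ln (p s) + a s * ln (A / T)" for s
    proof (cases "a s = 0")
      case False
      then have "0 < A / T" using a[of s] aA[of s] B by (simp add: T_def)
      then have "ln (qa s) = ln (p s) + ln (A / T)"
        unfolding qa_def by (intro ln_mult_pos p_pos)
      then show ?thesis by (simp add: distrib_left)
    qed simp
    then show ?thesis using qa_mass by simp
  qed
  also have "\<dots> = - (\<Sum>s\<in>UNIV. a s * ln (p s)) - A * ln (A / T)"
    by (simp add: sum.distrib A_def sum_distrib_right)
  \<comment> \<open>The weight \<open>A / T\<close> costs at most \<open>T - A = B\<close>, which
    becomes the summand \<open>1\<close> of \<open>\<mu>\<close>.\<close>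
  also have "\<dots> \<le> - (\<Sum>s\<in>UNIV. a s * ln (p s)) + B"
    using minus_mult_ln_ratio_le[of A T] A B by (simp add: T_def)
  also have "\<dots> \<le> - (\<Sum>s\<in>UNIV. (a s + 1) * ln (p s)) + B"
  proof -
    \<comment> \<open>The extra terms \<open>ln (p s)\<close> are nonpositive because
      \<open>p s \<le> 1\<close>.\<close>
    have "(\<Sum>s\<in>UNIV. (a s + 1) * ln (p s)) \<le> (\<Sum>s\<in>UNIV. a s * ln (p s))"
      using p_pos p_le by (intro sum_mono) (simp add: distrib_right)
    then show ?thesis by simp
  qed
  finally have a_part:
    "- (\<Sum>s\<in>UNIV. a s * ln (a s / T)) \<le> - (\<Sum>s\<in>UNIV. (a s + 1) * ln (p s)) + B" .

  have "- (\<Sum>i\<in>UNIV. b i * ln (b i / T)) \<le> - (\<Sum>i\<in>UNIV. b i * ln (qb i)) + T * sum qb UNIV - B"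
    unfolding B_def
  proof (rule gibbs_inequality_scaled)
    fix i
    show "b i \<le> T" using bB[of i] A by (simp add: T_def)
    show "0 \<le> qb i" using n A B by (simp add: qb_def T_def)
    assume "0 < b i"
    then show "0 < qb i" using n A bB[of i] by (simp add: qb_def T_def)
  qed (use b A B in \<open>auto simp: T_def\<close>)
  also have "\<dots> = - (B * ln (B / T / n))"
    using qb_mass by (simp add: qb_def B_def sum_distrib_right)
  also have "\<dots> = - (B * ln (B / T)) + B * ln n"
  proof (cases "B = 0")
    case False
    then have "0 < B / T" using A B by (simp add: T_def)
    then have "ln (B / T / n) = ln (B / T) - ln n"
      using n by (intro ln_divide_pos)
    then show ?thesis by (simp only: right_diff_distrib)
  qed simp
  \<comment> \<open>The weight \<open>B / T\<close> costs at most \<open>T - B = A\<close>, the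
    source of the final summand \<open>A\<close>.\<close>
  also have "\<dots> \<le> A + B * ln n"
    using minus_mult_ln_ratio_le[of B T] A B by (simp add: T_def)
  finally have b_part: "- (\<Sum>i\<in>UNIV. b i * ln (b i / T)) \<le> A + B * ln n" .

  have "- (\<Sum>s\<in>UNIV. a s * ln (a s / T)) - (\<Sum>i\<in>UNIV. b i * ln (b i / T))
      \<le> (1 + ln n) * B - (\<Sum>s\<in>UNIV. (a s + 1) * ln (p s)) + A"
    using add_mono[OF a_part b_part] by (simp add: algebra_simps)
  then show ?thesis
    unfolding T_def p_def n_def r_def .
qed

lemma vec_norm1_nonneg: "0 \<le> vec_norm1 v"
  by (simp add: vec_norm1_def sum_nonneg)

lemma mat_norm1_eq_sum_columns: "mat_norm1 A = (\<Sum>j\<in>UNIV. vec_norm1 (column j A))"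
  unfolding mat_norm1_def vec_norm1_def column_def by (subst sum.swap) simp

lemma power2_norm_matrix:
  fixes A :: "real ^ 'b ^ 'a"
  shows "(norm A)\<^sup>2 = (\<Sum>i\<in>UNIV. \<Sum>j\<in>UNIV. (A $ i $ j)\<^sup>2)"
  unfolding power2_norm_eq_inner inner_vec_def by (simp add: power2_eq_square)

lemma sum_in_Nats:
  fixes f :: "'a \<Rightarrow> 'b::semiring_1"
  shows "(\<And>i. i \<in> S \<Longrightarrow> f i \<in> \<nat>) \<Longrightarrow> sum f S \<in> \<nat>"
  by (induction S rule: infinite_finite_induct) auto

lemma binary_matrix_entry_Nats: "binary_matrix A \<Longrightarrow> A $ i $ j \<in> \<nat>"
  unfolding binary_matrix_def by (metis Nats_0 Nats_1 insertE singletonD)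

lemma binary_matrix_mult_transpose_Nats:
  assumes "binary_matrix X" "binary_matrix Y"
  shows "(Y ** transpose X) $ i $ j \<in> \<nat>"
  using assms
  by (auto simp: matrix_matrix_mult_def transpose_def
      intro!: sum_in_Nats Nats_mult binary_matrix_entry_Nats)

text \<open>A natural number is \<open>0\<close>, where both sides equal \<open>d\<close>, or at
  least \<open>1\<close>, where \<open>theta x = 1\<close> and an error occurs only for
  \<open>d = 0\<close>, with square \<open>x\<^sup>2 \<ge> 1\<close>.\<close>

lemma abs_minus_theta_le_square:
  assumes "d \<in> {0, 1}" "x \<in> \<nat>"
  shows "\<bar>d - theta x\<bar> \<le> (d - x)\<^sup>2"
proof (cases "x = 0")
  case False
  then have x: "1 \<le> x"
    using assms(2) by (metis Nats_cases of_nat_0_eq_iff of_nat_1 of_nat_le_iff less_one not_le)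
  then have "1 \<le> x\<^sup>2" by (simp add: one_le_power)
  with x show ?thesis using assms(1) by (auto simp: theta_def)
qed (use assms in \<open>auto simp: theta_def\<close>)

lemma mat_norm1_noise_le:
  assumes "binary_matrix D" "binary_matrix X" "binary_matrix Y"
  shows "mat_norm1 (noise_matrix X Y D) \<le> (norm (D - Y ** transpose X))\<^sup>2"
  unfolding mat_norm1_def power2_norm_matrix noise_matrix_def theta_matrix_def
  using assms binary_matrix_mult_transpose_Nats
  by (intro sum_mono) (auto simp: binary_matrix_def intro!: abs_minus_theta_le_square)

theorem theorem2:
  fixes D :: "real ^ 'n ^ 'm" and X :: "real ^ 'r ^ 'n" and Y :: "real ^ 'r ^ 'm" and \<mu> :: real
  assumes "binary_matrix D" and "binary_matrix X" and "binary_matrix Y"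
    and "\<mu> = 1 + ln (real CARD('n))"
  shows "f_CT X Y D \<le>
    \<mu> * (norm (D - Y ** transpose X))\<^sup>2
    - (\<Sum>s\<in>UNIV. (vec_norm1 (column s Y) + 1) *
         ln ((vec_norm1 (column s Y) + 1) / (mat_norm1 Y + real CARD('r))))
    + mat_norm1 Y"
proof -
  let ?N = "noise_matrix X Y D"
  have "f_CT X Y D \<le> \<mu> * mat_norm1 ?N
    - (\<Sum>s\<in>UNIV. (vec_norm1 (column s Y) + 1) *
         ln ((vec_norm1 (column s Y) + 1) / (mat_norm1 Y + real CARD('r))))
    + mat_norm1 Y"
    using two_group_code_length_le[of "\<lambda>s. vec_norm1 (column s Y)" "\<lambda>i. vec_norm1 (column i ?N)"]
    by (simp add: f_CT_def code_prob_def vec_norm1_nonneg assms(4) flip: mat_norm1_eq_sum_columns)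
  moreover have "0 \<le> \<mu>"
    by (simp add: assms(4) Suc_leI add_nonneg_nonneg)
  then have "\<mu> * mat_norm1 ?N \<le> \<mu> * (norm (D - Y ** transpose X))\<^sup>2"
    using mat_norm1_noise_le assms(1-3) by (intro mult_left_mono) auto
  ultimately show ?thesis by linarith
qed

end
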